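(* Let $(X,\operatorname{dist})$ be a compact metric space and let $f\colon X\to X$ be a recurrent homeomorphism. If $f$ is finite expansive or separating, then $X$ is a finite set.
   Context: Let $f\colon X\to X$ be a homeomorphism of a compact metric space $(X,\operatorname{dist})$. The homeomorphism $f$ is recurrent if for all $\epsilon>0$ there is $n\in\mathbb Z$, $n\neq 0$, such that $\operatorname{dist}(x,f^n(x))<\epsilon$ for all $x\in X$. The orbit of $x\in X$ is $O(x)=\{f^n(x):n\in\mathbb Z\}$. The homeomorphism $f$ is separating if there is $\eta>0$ such that whenever $x,y\in X$ and $y\notin O(x)$, one has $\operatorname{dist}(f^n(x),f^n(y))>\eta$ for some $n\in\mathbb Z$. For $x\in X$ and $\eta>0$ let $\Gamma_\eta(x)=\{y\in X:\operatorname{dist}(f^k(x),f^k(y))\leq\eta\text{ for all }k\in\mathbb Z\}$. The homeomorphism $f$ is finite expansive if there is $\eta>0$ such that $\Gamma_\eta(x)$ is a finite set for every $x\in X$. *)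

theory Defs
  imports "HOL-Analysis.Analysis"
begin

(* The space is a subset X of a metric-space type, with the restricted metric; X may be empty.
   All notions depend only on X, the metric on X, and the restriction to X of a bijection f of X. *)

(* For negative n the inverse is taken relative to X, since f is unconstrained off X. *)
definition int_iterate :: "'a set \<Rightarrow> ('a \<Rightarrow> 'a) \<Rightarrow> int \<Rightarrow> 'a \<Rightarrow> 'a" where
  "int_iterate X f n x =
     (if n \<ge> 0 then (f ^^ nat n) x else (inv_into X f ^^ nat (- n)) x)"

definition full_orbit :: "'a set \<Rightarrow> ('a \<Rightarrow> 'a) \<Rightarrow> 'a \<Rightarrow> 'a set" where
  "full_orbit X f x = {int_iterate X f n x | n. n \<in> (UNIV :: int set)}"

definition recurrent_homeo :: "'a::metric_space set \<Rightarrow> ('a \<Rightarrow> 'a) \<Rightarrow> bool" where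
  "recurrent_homeo X f \<longleftrightarrow>
     (\<forall>\<epsilon>>0. \<exists>n::int. n \<noteq> 0 \<and> (\<forall>x\<in>X. dist x (int_iterate X f n x) < \<epsilon>))"

definition separating_homeo :: "'a::metric_space set \<Rightarrow> ('a \<Rightarrow> 'a) \<Rightarrow> bool" where
  "separating_homeo X f \<longleftrightarrow>
     (\<exists>\<eta>>0. \<forall>x\<in>X. \<forall>y\<in>X. y \<notin> full_orbit X f x \<longrightarrow>
        (\<exists>n::int. dist (int_iterate X f n x) (int_iterate X f n y) > \<eta>))"

definition dynamical_ball :: "'a::metric_space set \<Rightarrow> ('a \<Rightarrow> 'a) \<Rightarrow> real \<Rightarrow> 'a \<Rightarrow> 'a set" where
  "dynamical_ball X f \<eta> x =
     {y \<in> X. \<forall>k::int. dist (int_iterate X f k x) (int_iterate X f k y) \<le> \<eta>}"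

definition finite_expansive_homeo :: "'a::metric_space set \<Rightarrow> ('a \<Rightarrow> 'a) \<Rightarrow> bool" where
  "finite_expansive_homeo X f \<longleftrightarrow> (\<exists>\<eta>>0. \<forall>x\<in>X. finite (dynamical_ball X f \<eta> x))"

end

theory Submission
  imports Defs
begin

text \<open>
  Write \<open>\<Gamma>\<^sub>\<eta>(x)\<close> for the set of points whose full orbit stays within \<open>\<eta>\<close> of the orbit
  of \<open>x\<close>. The proof passes through periodic points.

  Recurrence makes every point periodic as soon as the sets \<open>\<Gamma>\<^sub>\<eta>(x)\<close> are countable
  (lemma \<open>recurrent_imp_periodic\<close>): a power of \<open>f\<close> that is uniformly \<open>\<eta>\<close>-close to the
  identity commutes with \<open>f\<close>, so it moves \<open>x\<close> inside \<open>\<Gamma>\<^sub>\<eta>(x)\<close>. If \<open>x\<close> is not periodic,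
  such returns accumulate on one another, and their closure is a nonempty perfect compact
  subset of \<open>\<Gamma>\<^sub>\<eta>(x)\<close>, hence uncountable.

  Both alternatives of the theorem provide countability. In the finite expansive case
  \<open>\<Gamma>\<^sub>\<eta>(x)\<close> is even finite. In the separating case \<open>\<Gamma>\<^sub>\<eta>(x)\<close> lies in the orbit of \<open>x\<close>,
  which is countable; once \<open>x\<close> is known to be periodic the orbit is finite, and so
  \<open>\<Gamma>\<^sub>\<eta>(x)\<close> is finite again.

  It remains to treat a pointwise periodic homeomorphism with finite sets \<open>\<Gamma>\<^sub>\<eta>(x)\<close>
  (lemma \<open>periodic_finite_dyn_ball_imp_finite\<close>). If \<open>X\<close> is infinite, compactness gives a
  non-isolated point \<open>x\<close>. For each \<open>r\<close> in \<open>(0, \<eta>]\<close>, following points close to \<open>x\<close> until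
  their orbits first depart from the orbit of \<open>x\<close> by more than \<open>r\<close> and passing to a limit
  produces a point \<open>w\<close> of \<open>\<Gamma>\<^sub>\<eta>(x)\<close> for which the largest distance between \<open>f\<^sup>k(x)\<close> and
  \<open>f\<^sup>k(w)\<close> is exactly \<open>r\<close> (lemma \<open>exit_point\<close>). Different \<open>r\<close> give different points, contradicting finiteness.
\<close>

section \<open>Perfect sets\<close>

lemma uncountable_compact_perfect:
  fixes P :: "'a::metric_space set"
  assumes "compact P" "P \<noteq> {}" and lim: "\<And>x. x \<in> P \<Longrightarrow> x islimpt P"
  shows "uncountable P"
proof -
  have "locally_compact_space (top_of_set P)"
    using assms(1) by (simp add: compact_imp_locally_compact_space compact_space_subtopology)
  moreover have "Hausdorff_space (top_of_set P)"
    by (simp add: Hausdorff_space_subtopology)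
  moreover have "top_of_set P derived_set_of P = P"
    using lim by (fastforce simp: derived_set_of_def islimpt_def openin_open)
  ultimately have "(UNIV :: real set) \<lesssim> P"
    using assms(2) lepoll_perfect_set by blast
  then show ?thesis
    by (metis uncountable_UNIV_real countable_lepoll)
qed

section \<open>Continuous actions of the integers\<close>

text \<open>
  The argument uses only the group law and the continuity of the integer iterates, so it is
  carried out for an abstract action; the sign cases of the iterates then matter only once,
  in \<open>homeomorphism_compact_int_action\<close>.
\<close>

locale compact_int_action =
  fixes X :: "'a::metric_space set" and \<phi> :: "int \<Rightarrow> 'a \<Rightarrow> 'a"
  assumes compact: "compact X"
    and act_zero: "\<And>x. x \<in> X \<Longrightarrow> \<phi> 0 x = x"
    and act_add: "\<And>m n x. x \<in> X \<Longrightarrow> \<phi> (m + n) x = \<phi> m (\<phi> n x)"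
    and act_in: "\<And>n x. x \<in> X \<Longrightarrow> \<phi> n x \<in> X"
    and act_cont: "\<And>n. continuous_on X (\<phi> n)"
begin

definition dyn_ball :: "real \<Rightarrow> 'a \<Rightarrow> 'a set" where
  "dyn_ball \<eta> x = {y \<in> X. \<forall>k. dist (\<phi> k x) (\<phi> k y) \<le> \<eta>}"

lemma dyn_ball_mono: "r \<le> s \<Longrightarrow> dyn_ball r x \<subseteq> dyn_ball s x"
  unfolding dyn_ball_def using order_trans by blast

lemma act_tendsto:
  assumes "y \<longlonglongrightarrow> z" "\<And>j. y j \<in> X" "z \<in> X"
  shows "(\<lambda>j. \<phi> k (y j)) \<longlonglongrightarrow> \<phi> k z"
  using continuous_on_tendsto_compose[OF act_cont[of k] assms(1,3)] assms(2) by simp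

lemma compact_dyn_ball: "compact (dyn_ball \<eta> x)"
proof -
  have "dyn_ball \<eta> x = X \<inter> (\<Inter>k. X \<inter> \<phi> k -` cball (\<phi> k x) \<eta>)"
    by (auto simp: dyn_ball_def)
  moreover have "closed (X \<inter> \<phi> k -` cball (\<phi> k x) \<eta>)" for k
    using continuous_on_closed_vimage[OF compact_imp_closed[OF compact], of "\<phi> k"] act_cont[of k]
    by (metis closed_cball Int_commute)
  then have "closed (\<Inter>k. X \<inter> \<phi> k -` cball (\<phi> k x) \<eta>)"
    by blast
  ultimately show ?thesis
    using compact_Int_closed[OF compact] by (simp only:)
qed

lemma act_period_multiple:
  assumes "x \<in> X" "\<phi> p x = x"
  shows "\<phi> (m + j * p) x = \<phi> m x"
proof -
  have nat: "\<phi> (int n * p) x = x" for n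
  proof (induction n)
    case (Suc n)
    have "\<phi> (int n * p + p) x = x"
      using act_add[OF assms(1)] assms(2) Suc by simp
    then show ?case by (simp add: algebra_simps)
  qed (use assms act_zero in simp)
  have "\<phi> (j * p) x = x"
  proof (cases "j \<ge> 0")
    case True
    then show ?thesis using nat[of "nat j"] by simp
  next
    case False
    have "\<phi> (j * p + (- j) * p) x = \<phi> (j * p) (\<phi> ((- j) * p) x)"
      using act_add[OF assms(1)] .
    then show ?thesis using nat[of "nat (- j)"] False act_zero assms(1) by simp
  qed
  then show ?thesis using act_add[OF assms(1)] by simp
qed

definition periodic :: "'a \<Rightarrow> bool" where
  "periodic x \<longleftrightarrow> (\<exists>p>0. \<phi> p x = x)"

lemma common_period:
  assumes "x \<in> X" "y \<in> X" "periodic x" "periodic y"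
  shows "\<exists>p>0. \<forall>m j. \<phi> (m + j * p) x = \<phi> m x \<and> \<phi> (m + j * p) y = \<phi> m y"
proof -
  obtain p q where "p > 0" "\<phi> p x = x" "q > 0" "\<phi> q y = y"
    using assms unfolding periodic_def by blast
  then show ?thesis
    using act_period_multiple[OF assms(1), of p] act_period_multiple[OF assms(2), of q]
    by (intro exI[of _ "p * q"]) (metis mult.assoc mult.commute mult_pos_pos)
qed

lemma finite_periodic_orbit:
  assumes "x \<in> X" "periodic x"
  shows "finite (range (\<lambda>n. \<phi> n x))"
proof -
  obtain p where p: "p > 0" "\<phi> p x = x" using assms unfolding periodic_def by blast
  have "\<phi> n x = \<phi> (n mod p) x" for n
    using act_period_multiple[OF assms(1) p(2), of "n mod p" "n div p"] by simp
  then have "range (\<lambda>n. \<phi> n x) \<subseteq> (\<lambda>n. \<phi> n x) ` {0..<p}"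
    using p(1) by (metis (no_types, lifting) atLeastLessThan_iff image_eqI image_subsetI
        pos_mod_bound pos_mod_sign)
  then show ?thesis by (meson finite_atLeastLessThan_int finite_imageI finite_subset)
qed

section \<open>Recurrence and periodic points\<close>

definition recurrent :: bool where
  "recurrent \<longleftrightarrow> (\<forall>\<epsilon>>0. \<exists>n. n \<noteq> 0 \<and> (\<forall>x\<in>X. dist x (\<phi> n x) < \<epsilon>))"

text \<open>
  The returns \<open>\<phi> n x\<close>, for the times \<open>n\<close> at which \<open>\<phi> n\<close> is uniformly closer to the identity
  than \<open>\<eta>\<close>, lie in the dynamical ball because \<open>\<phi> n\<close> commutes with the action. Composing with
  a further \<open>\<phi> m\<close>, \<open>m \<noteq> 0\<close>, even closer to the identity moves a return slightly to another
  return, which is a different point when \<open>x\<close> is not periodic. So no return is isolated, and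
  the closure of the set of returns is a perfect set inside the dynamical ball.
\<close>

lemma recurrent_imp_periodic:
  assumes rec: "recurrent" and "\<eta> > 0" and x: "x \<in> X" and count: "countable (dyn_ball \<eta> x)"
  shows "periodic x"
proof (rule ccontr)
  assume np: "\<not> periodic x"
  have moves: "\<phi> m x \<noteq> x" if m: "m \<noteq> 0" for m
  proof
    assume e: "\<phi> m x = x"
    then have "\<phi> (-m) x = x" using act_add[OF x, of "-m" m] act_zero[OF x] by simp
    with e m np show False unfolding periodic_def by (metis linorder_neqE neg_0_less_iff_less)
  qed
  \<comment> \<open>The bound is kept strictly below \<open>\<eta>\<close> to leave room for composing with one more small return.\<close>
  define S where "S = {\<phi> n x | n. \<exists>\<epsilon><\<eta>. \<forall>y\<in>X. dist y (\<phi> n y) \<le> \<epsilon>}"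
  have "S \<subseteq> dyn_ball \<eta> x"
  proof
    fix y assume "y \<in> S"
    then obtain n \<epsilon> where n: "y = \<phi> n x" "\<epsilon> < \<eta>" "\<forall>y\<in>X. dist y (\<phi> n y) \<le> \<epsilon>"
      unfolding S_def by blast
    have "dist (\<phi> k x) (\<phi> k y) \<le> \<eta>" for k
    proof -
      have "\<phi> k y = \<phi> n (\<phi> k x)"
        using act_add[OF x, of k n] act_add[OF x, of n k] n(1) by (simp add: add.commute)
      then show ?thesis using n act_in[OF x, of k] by force
    qed
    then show "y \<in> dyn_ball \<eta> x" using act_in[OF x] n(1) unfolding dyn_ball_def by blast
  qed
  then have sub: "closure S \<subseteq> dyn_ball \<eta> x"
    by (simp add: closure_minimal compact_dyn_ball compact_imp_closed)
  have lim: "y islimpt S" if "y \<in> S" for y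
    unfolding islimpt_approachable
  proof (intro allI impI)
    fix e :: real assume "0 < e"
    obtain n \<epsilon> where n: "y = \<phi> n x" "\<epsilon> < \<eta>" "\<forall>y\<in>X. dist y (\<phi> n y) \<le> \<epsilon>"
      using \<open>y \<in> S\<close> unfolding S_def by blast
    define d where "d = min e ((\<eta> - \<epsilon>) / 2)"
    have "d > 0" using \<open>0 < e\<close> n(2) unfolding d_def by simp
    then obtain m where m: "m \<noteq> 0" "\<forall>y\<in>X. dist y (\<phi> m y) < d"
      using rec unfolding recurrent_def by blast
    have y: "y \<in> X" using n(1) act_in[OF x] by simp
    have "dist z (\<phi> (m + n) z) \<le> \<epsilon> + d" if z: "z \<in> X" for z
    proof -
      have "dist z (\<phi> n z) \<le> \<epsilon>" "dist (\<phi> n z) (\<phi> m (\<phi> n z)) < d"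
        using n(3) m(2) z act_in by auto
      then show ?thesis using dist_triangle[of z "\<phi> m (\<phi> n z)" "\<phi> n z"] act_add[OF z] by simp
    qed
    moreover have "\<epsilon> + d < \<eta>" using n(2) unfolding d_def by (simp add: min_def field_simps)
    moreover have *: "\<phi> m y = \<phi> (m + n) x" using act_add[OF x] n(1) by simp
    ultimately have "\<phi> m y \<in> S" unfolding S_def by blast
    moreover have "\<phi> m y \<noteq> y"
    proof
      assume "\<phi> m y = y"
      then have "\<phi> (-n + (m + n)) x = \<phi> (-n + n) x"
        using * n(1) act_add[OF x] by metis
      then show False using moves[OF m(1)] act_zero[OF x] by simp
    qed
    moreover have "dist (\<phi> m y) y < e" using m(2) y unfolding d_def by (auto simp: dist_commute)
    ultimately show "\<exists>x'\<in>S. x' \<noteq> y \<and> dist x' y < e" by blast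
  qed
  have "x \<in> S"
    unfolding S_def using act_zero x \<open>\<eta> > 0\<close> by (auto intro!: exI[of _ 0])
  moreover have "z islimpt closure S" if "z \<in> closure S" for z
    using that lim unfolding limpt_of_closure unfolding closure_def by blast
  moreover have "compact (closure S)"
    using sub compact_dyn_ball by (metis closed_closure compact_Int_closed inf.absorb_iff2)
  ultimately have "uncountable (closure S)"
    using uncountable_compact_perfect[of "closure S"] by (metis closure_eq_empty empty_iff)
  with sub count show False using countable_subset by blast
qed

section \<open>Pointwise periodic actions\<close>

text \<open>
  Points \<open>y j \<noteq> x\<close> of \<open>X\<close> close enough to \<open>x\<close> avoid the finite set \<open>dyn_ball r x\<close>, so if
  they converge to \<open>x\<close> their orbits depart from the orbit of \<open>x\<close> by more than \<open>r\<close>, and by periodicity they do so in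
  forward time. By continuity the first exit times tend to infinity. A limit of the pairs at
  the exit times is therefore a pair of points that are at least \<open>r\<close> apart now but at most
  \<open>r\<close> apart at every negative time. Both being periodic, every time, including the
  present, is equivalent to a negative one, so the distance never exceeds \<open>r\<close> and equals
  \<open>r\<close> now. Since the orbit of \<open>x\<close> is finite, the first point of the pair is on it, and
  translating back gives \<open>w\<close>.
\<close>

lemma exit_point:
  assumes per: "\<And>y. y \<in> X \<Longrightarrow> periodic y"
    and x: "x \<in> X" and lim: "x islimpt X"
    and r: "r > 0" and fin: "finite (dyn_ball r x)"
  obtains w k where "w \<in> dyn_ball r x" "dist (\<phi> k x) (\<phi> k w) = r"
proof -
  obtain \<delta> where \<delta>: "\<delta> > 0" "\<forall>y\<in>dyn_ball r x. y \<noteq> x \<longrightarrow> \<delta> \<le> dist x y"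
    using finite_set_avoid[OF fin, of x] by (elim exE conjE)
  have exits: "\<exists>n. dist (\<phi> (int n) x) (\<phi> (int n) y) > r"
    if y: "y \<in> X" "y \<noteq> x" "dist x y < \<delta>" for y
  proof -
    have "y \<notin> dyn_ball r x"
      using \<delta>(2) y by (meson not_le)
    then obtain k where k: "dist (\<phi> k x) (\<phi> k y) > r"
      using y(1) unfolding dyn_ball_def by (auto simp: not_le)
    obtain p where p: "p > 0" "\<forall>m j. \<phi> (m + j * p) x = \<phi> m x \<and> \<phi> (m + j * p) y = \<phi> m y"
      using common_period[OF x y(1) per[OF x] per[OF y(1)]] by (elim exE conjE)
    have "dist (\<phi> (int (nat (k mod p))) x) (\<phi> (int (nat (k mod p))) y) > r"
      using k p(1) p(2)[rule_format, of "k mod p" "k div p"] by simp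
    then show ?thesis by blast
  qed
  obtain u where u: "\<And>j::nat. u j \<in> X - {x}" "u \<longlonglongrightarrow> x"
    using lim islimpt_sequential by blast
  have "eventually (\<lambda>j. dist (u j) x < \<delta>) sequentially"
    using u(2) \<delta>(1) tendstoD by blast
  then obtain J where "\<And>j. j \<ge> J \<Longrightarrow> dist (u j) x < \<delta>"
    unfolding eventually_sequentially by blast
  define y where "y = (\<lambda>j. u (j + J))"
  have y: "y j \<in> X" "y j \<noteq> x" "dist x (y j) < \<delta>" for j
    using u(1) \<open>\<And>j. j \<ge> J \<Longrightarrow> dist (u j) x < \<delta>\<close>[of "j + J"]
    unfolding y_def by (auto simp: dist_commute)
  have y_lim: "y \<longlonglongrightarrow> x" unfolding y_def using u(2) by (rule LIMSEQ_ignore_initial_segment)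
  define t where "t = (\<lambda>j. LEAST n. dist (\<phi> (int n) x) (\<phi> (int n) (y j)) > r)"
  have t_exit: "dist (\<phi> (int (t j)) x) (\<phi> (int (t j)) (y j)) > r" for j
    unfolding t_def using LeastI_ex[OF exits[OF y]] .
  have t_stay: "dist (\<phi> (int n) x) (\<phi> (int n) (y j)) \<le> r" if "n < t j" for n j
    using not_less_Least[OF that[unfolded t_def]] by (simp add: not_less)
  have t_large: "eventually (\<lambda>j. k < t j) sequentially" for k
  proof -
    have "eventually (\<lambda>j. dist (\<phi> (int n) (y j)) (\<phi> (int n) x) < r) sequentially" for n
      using act_tendsto[OF y_lim y(1) x] r tendstoD by blast
    then have "eventually (\<lambda>j. \<forall>n\<in>{..k}. dist (\<phi> (int n) (y j)) (\<phi> (int n) x) < r) sequentially"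
      by (intro eventually_ball_finite) auto
    then show ?thesis
    proof eventually_elim
      case (elim j)
      show ?case
      proof (rule ccontr)
        assume "\<not> k < t j"
        then have "dist (\<phi> (int (t j)) (y j)) (\<phi> (int (t j)) x) < r" using elim by simp
        then show False using t_exit[of j] by (simp add: dist_commute)
      qed
    qed
  qed
  define a where "a = (\<lambda>j. \<phi> (int (t j)) x)"
  define b where "b = (\<lambda>j. \<phi> (int (t j)) (y j))"
  have ab: "a j \<in> range (\<lambda>n. \<phi> n x)" "a j \<in> X" "b j \<in> X" for j
    unfolding a_def b_def using act_in x y(1) by auto
  have "compact (range (\<lambda>n. \<phi> n x) \<times> X)"
    using compact_Times[OF finite_imp_compact[OF finite_periodic_orbit[OF x per[OF x]]] compact] .
  moreover have "\<forall>j. (a j, b j) \<in> range (\<lambda>n. \<phi> n x) \<times> X"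
    using ab by blast
  ultimately obtain q s where q: "q \<in> range (\<lambda>n. \<phi> n x) \<times> X" and s: "strict_mono s"
    and conv: "((\<lambda>j. (a j, b j)) \<circ> s) \<longlonglongrightarrow> q"
    unfolding compact_def by meson
  \<comment> \<open>The limit of the first components is again on the finite, hence closed, orbit of \<open>x\<close>.\<close>
  obtain m z where qm: "q = (\<phi> m x, z)" and z: "z \<in> X" using q by blast
  have a_lim: "(\<lambda>j. a (s j)) \<longlonglongrightarrow> \<phi> m x" and b_lim: "(\<lambda>j. b (s j)) \<longlonglongrightarrow> z"
    using tendsto_fst[OF conv] tendsto_snd[OF conv] qm by (simp_all add: o_def)
  have mx: "\<phi> m x \<in> X" using act_in x by blast
  have ge: "r \<le> dist (\<phi> m x) z"
    using tendsto_lowerbound[OF tendsto_dist[OF a_lim b_lim], of r] t_exit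
    by (simp add: a_def b_def less_imp_le)
  have past: "dist (\<phi> (- int k) (\<phi> m x)) (\<phi> (- int k) z) \<le> r" if "k > 0" for k
  proof (rule tendsto_upperbound)
    show "(\<lambda>j. dist (\<phi> (- int k) (a (s j))) (\<phi> (- int k) (b (s j))))
        \<longlonglongrightarrow> dist (\<phi> (- int k) (\<phi> m x)) (\<phi> (- int k) z)"
      by (intro tendsto_dist act_tendsto a_lim b_lim mx z ab)
    have "eventually (\<lambda>j. k < t (s j)) sequentially"
      using eventually_subseq[OF s t_large[of k]] .
    then show "\<forall>\<^sub>F j in sequentially. dist (\<phi> (- int k) (a (s j))) (\<phi> (- int k) (b (s j))) \<le> r"
    proof eventually_elim
      case (elim j)
      have "\<phi> (- int k) (\<phi> (int (t (s j))) v) = \<phi> (int (t (s j) - k)) v" if "v \<in> X" for v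
        using act_add[OF that, of "- int k" "int (t (s j))"] elim by (simp add: of_nat_diff)
      then show ?case using t_stay[of "t (s j) - k" "s j"] elim \<open>k > 0\<close> x y(1)
        unfolding a_def b_def by simp
    qed
  qed simp
  obtain p where p: "p > 0"
      "\<forall>i j. \<phi> (i + j * p) (\<phi> m x) = \<phi> i (\<phi> m x) \<and> \<phi> (i + j * p) z = \<phi> i z"
    using common_period[OF mx z per[OF mx] per[OF z]] by (elim exE conjE)
  have all: "dist (\<phi> i (\<phi> m x)) (\<phi> i z) \<le> r" for i
  proof -
    \<comment> \<open>The summand \<open>p\<close> makes \<open>k\<close> positive also when \<open>p\<close> divides \<open>i\<close>, in particular for \<open>i = 0\<close>.\<close>
    define k where "k = nat ((- i) mod p + p)"
    have k: "int k = (- i) mod p + p" unfolding k_def using p(1) by (simp add: add_nonneg_nonneg)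
    then have "k > 0" using p(1) by (smt (verit) of_nat_0_less_iff pos_mod_sign)
    have "- int k = i + ((- i) div p - 1) * p"
      using div_mult_mod_eq[of "- i" p] unfolding k left_diff_distrib by linarith
    then show ?thesis using past[OF \<open>k > 0\<close>] p(2) by simp
  qed
  define w where "w = \<phi> (- m) z"
  have shift: "dist (\<phi> k x) (\<phi> k w) = dist (\<phi> (k - m) (\<phi> m x)) (\<phi> (k - m) z)" for k
    using act_add[OF z, of k "-m"] act_add[OF x, of "k - m" m] unfolding w_def by simp
  have "w \<in> dyn_ball r x"
    using all act_in[OF z, of "- m"] shift unfolding dyn_ball_def w_def by simp
  moreover have "dist (\<phi> m x) (\<phi> m w) = r"
  proof -
    have "dist (\<phi> m x) (\<phi> m w) = dist (\<phi> m x) z"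
      using shift[of m] act_zero[OF mx] act_zero[OF z] by simp
    moreover have "dist (\<phi> m x) z \<le> r"
      using all[of 0] act_zero[OF mx] act_zero[OF z] by simp
    ultimately show ?thesis using ge by linarith
  qed
  ultimately show ?thesis using that by blast
qed

text \<open>
  A point \<open>w\<close> determines the largest distance between \<open>\<phi> k x\<close> and \<open>\<phi> k w\<close>. All values
  \<open>r\<close> in \<open>(0, \<eta>]\<close> are attained if \<open>x\<close> is a limit point of \<open>X\<close>, so the dynamical ball of \<open>x\<close> would be
  infinite.
\<close>

lemma periodic_finite_dyn_ball_imp_finite:
  assumes per: "\<And>y. y \<in> X \<Longrightarrow> periodic y"
    and \<eta>: "\<eta> > 0" and fin: "\<And>y. y \<in> X \<Longrightarrow> finite (dyn_ball \<eta> y)"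
  shows "finite X"
proof (rule ccontr)
  assume "infinite X"
  then obtain x where x: "x \<in> X" "x islimpt X"
    using compact compact_eq_Bolzano_Weierstrass by blast
  have "\<exists>w. w \<in> dyn_ball r x \<and> (\<exists>k. dist (\<phi> k x) (\<phi> k w) = r)" if "r \<in> {0<..\<eta>}" for r
    using that exit_point[OF per x, of r] fin[OF x(1)] dyn_ball_mono[of r \<eta> x]
    by (metis finite_subset greaterThanAtMost_iff)
  then obtain W where W: "\<And>r. r \<in> {0<..\<eta>} \<Longrightarrow> W r \<in> dyn_ball r x"
      "\<And>r. r \<in> {0<..\<eta>} \<Longrightarrow> \<exists>k. dist (\<phi> k x) (\<phi> k (W r)) = r"
    by metis
  have "inj_on W {0<..\<eta>}"
  proof (rule linorder_inj_onI)
    fix r s assume rs: "r < s" "r \<in> {0<..\<eta>}" "s \<in> {0<..\<eta>}"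
    obtain k where "dist (\<phi> k x) (\<phi> k (W s)) = s" using W(2)[OF rs(3)] by blast
    moreover have "dist (\<phi> k x) (\<phi> k (W r)) \<le> r" using W(1)[OF rs(2)] unfolding dyn_ball_def by blast
    ultimately show "W r \<noteq> W s" using rs(1) by auto
  qed auto
  moreover have "W ` {0<..\<eta>} \<subseteq> dyn_ball \<eta> x"
    using W(1) dyn_ball_mono by fastforce
  ultimately have "finite {0<..\<eta>}"
    using fin[OF x(1)] by (meson finite_imageD finite_subset)
  then show False using infinite_Ioc[OF \<eta>] by blast
qed

end

section \<open>The action generated by a homeomorphism\<close>

lemma funpow_diff_inverse:
  assumes "\<And>x. x \<in> X \<Longrightarrow> f x \<in> X" "\<And>x. x \<in> X \<Longrightarrow> g (f x) = x" "x \<in> X"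
  shows "(g ^^ m) ((f ^^ n) x) = (if m \<le> n then (f ^^ (n - m)) x else (g ^^ (m - n)) x)"
  using assms(3)
proof (induction n arbitrary: m)
  case (Suc n)
  have "(f ^^ n) x \<in> X" using Suc.prems assms(1) by (induction n) auto
  then show ?case using Suc assms(2)
    by (cases m) (auto simp del: funpow.simps simp: funpow_0 funpow_Suc_right funpow_swap1[symmetric])
qed auto

lemma homeomorphism_compact_int_action:
  fixes X :: "'a::metric_space set"
  assumes "compact X" and homeo: "homeomorphism X X f g"
  shows "compact_int_action X (int_iterate X f)"
proof -
  have f: "f x \<in> X" "g (f x) = x" and g: "g x \<in> X" "f (g x) = x" if "x \<in> X" for x
    using homeo that unfolding homeomorphism_def by auto
  have fn: "(f ^^ n) x \<in> X" and gn: "(g ^^ n) x \<in> X" if "x \<in> X" for n x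
    using that f(1) g(1) by (induction n) auto
  have "inv_into X f x = g x" if "x \<in> X" for x
    using f g that by (metis inj_on_inverseI inv_into_f_eq)
  then have "(inv_into X f ^^ n) x = (g ^^ n) x" if "x \<in> X" for n x
    using gn that by (induction n) auto
  then have iter: "int_iterate X f n x = (if n \<ge> 0 then (f ^^ nat n) x else (g ^^ nat (- n)) x)"
    if "x \<in> X" for n x
    using that unfolding int_iterate_def by simp
  show ?thesis
  proof
    show "compact X" by fact
    show "int_iterate X f 0 x = x" if "x \<in> X" for x
      using that by (simp add: iter)
    show iter_in: "int_iterate X f n x \<in> X" if "x \<in> X" for n x
      using that fn gn by (simp add: iter)
    show "int_iterate X f (m + n) x = int_iterate X f m (int_iterate X f n x)" if x: "x \<in> X" for m n x
    proof -
      note gf = funpow_diff_inverse[of X f g, OF f x]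
      note fg = funpow_diff_inverse[of X g f, OF g x]
      have nm: "nat (m + n) = nat m + nat n" if "m \<ge> 0" "n \<ge> 0" using that by (simp add: nat_add_distrib)
      have nm': "nat (- m - n) = nat (- m) + nat (- n)" if "m < 0" "n < 0"
        using that by linarith
      consider "m \<ge> 0" "n \<ge> 0" | "m < 0" "n < 0" | "m < 0" "n \<ge> 0" | "m \<ge> 0" "n < 0" by linarith
      then show ?thesis
      proof cases
        case 1 then show ?thesis
          using x fn by (simp add: iter nm funpow_add)
      next
        case 2 then show ?thesis
          using x gn by (simp add: iter nm' funpow_add)
      next
        case 3
        have "nat n - nat (- m) = nat (m + n)" "nat (- m) - nat n = nat (- (m + n))" using 3 by linarith+
        then show ?thesis using 3 x fn gf[of "nat (- m)" "nat n"]
          by (auto simp: iter)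
      next
        case 4
        have "nat m - nat (- n) = nat (m + n)" "nat (- n) - nat m = nat (- (m + n))" using 4 by linarith+
        then show ?thesis using 4 x gn fg[of "nat m" "nat (- n)"]
          by (auto simp: iter)
      qed
    qed
    show "continuous_on X (int_iterate X f n)" for n
    proof -
      have pow: "continuous_on X (h ^^ k)" if "continuous_on X h" "\<And>x. x \<in> X \<Longrightarrow> h x \<in> X"
        for h :: "'a \<Rightarrow> 'a" and k
      proof (induction k)
        case (Suc k)
        have "(h ^^ k) x \<in> X" if "x \<in> X" for x
          using that \<open>\<And>x. x \<in> X \<Longrightarrow> h x \<in> X\<close> by (induction k) auto
        then have "continuous_on X (h \<circ> (h ^^ k))"
          using Suc that(1) by (meson continuous_on_compose continuous_on_subset image_subsetI)
        then show ?case by simp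
      qed (simp add: id_def)
      have "continuous_on X (\<lambda>x. if n \<ge> 0 then (f ^^ nat n) x else (g ^^ nat (- n)) x)"
        using pow[of f "nat n"] pow[of g "nat (- n)"] homeo f(1) g(1)
        unfolding homeomorphism_def by (cases "n \<ge> 0") auto
      then show ?thesis
        using iter by (simp cong: continuous_on_cong)
    qed
  qed
qed

theorem theorem3p2:
  fixes X :: "'a::metric_space set" and f g :: "'a \<Rightarrow> 'a"
  assumes "compact X"
    and "homeomorphism X X f g"
    and "recurrent_homeo X f"
    and "finite_expansive_homeo X f \<or> separating_homeo X f"
  shows "finite X"
proof -
  interpret compact_int_action X "int_iterate X f"
    using homeomorphism_compact_int_action assms(1,2) .
  have ball: "dynamical_ball X f = dyn_ball"
    unfolding dynamical_ball_def dyn_ball_def by blast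
  have rec: recurrent
    using assms(3) unfolding recurrent_homeo_def recurrent_def .
  show ?thesis
    using assms(4)
  proof
    assume "finite_expansive_homeo X f"
    then obtain \<eta> where \<eta>: "\<eta> > 0" "\<And>x. x \<in> X \<Longrightarrow> finite (dyn_ball \<eta> x)"
      unfolding finite_expansive_homeo_def ball by blast
    then show ?thesis
      using recurrent_imp_periodic[OF rec] periodic_finite_dyn_ball_imp_finite countable_finite by metis
  next
    assume "separating_homeo X f"
    then obtain \<eta> where \<eta>: "\<eta> > 0" and sep: "\<And>x y. x \<in> X \<Longrightarrow> y \<in> X \<Longrightarrow> y \<notin> full_orbit X f x \<Longrightarrow>
        \<exists>n. dist (int_iterate X f n x) (int_iterate X f n y) > \<eta>"
      unfolding separating_homeo_def by blast
    have sub: "dyn_ball \<eta> x \<subseteq> range (\<lambda>n. int_iterate X f n x)" if "x \<in> X" for x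
      using sep[OF that] unfolding dyn_ball_def full_orbit_def
      by (smt (verit) mem_Collect_eq rangeI subsetI)
    have per: "periodic x" if "x \<in> X" for x
      using recurrent_imp_periodic[OF rec \<eta> that] countable_subset[OF sub[OF that]] by simp
    have "finite (dyn_ball \<eta> x)" if "x \<in> X" for x
      using finite_subset[OF sub[OF that] finite_periodic_orbit[OF that per[OF that]]] .
    with per \<eta> show ?thesis
      using periodic_finite_dyn_ball_imp_finite by blast
  qed
qed

end
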